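(* Let $b_1,b_2\ge1$. Let $G$ be the graph obtained from the star $\mathcal S_{1,b_1}$ and the spider $\mathcal S_{2,b_2}$ by identifying the center $v_1$ of $\mathcal S_{1,b_1}$ (degree $b_1$) with the center $v_2$ of $\mathcal S_{2,b_2}$ (degree $b_2$). Then $B(G)=\binom{b_1}{2}$.
   Context: For $a,b\ge1$, $\mathcal S_{a,b}$ denotes the tree consisting of $b$ paths, each with $a$ edges, sharing one common endpoint (the center); thus $\mathcal S_{1,b}$ is a star with $b$ leaves. For a connected graph $G$, $\kappa(G)$ is Kemeny's constant of the simple random walk on $G$: $\kappa(G)=\sum_{j\ne i}m_{ij}\pi_j$ ($m_{ij}$ mean first passage time, $\pi$ stationary distribution). A pair of nonadjacent vertices is a Braess edge of $G$ if adding the edge between them strictly increases $\kappa$; $B(G)$ is the number of Braess edges of $G$. *)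

theory Defs
  imports "HOL-Probability.Probability"
begin

text \<open>A simple graph is a pair of a vertex set and a set of edges, each edge being a
  two-element set of vertices.\<close>

type_synonym 'a ugraph = "'a set \<times> 'a set set"

definition verts :: "'a ugraph \<Rightarrow> 'a set" where
  "verts G = fst G"

definition edges :: "'a ugraph \<Rightarrow> 'a set set" where
  "edges G = snd G"

definition neighbours :: "'a ugraph \<Rightarrow> 'a \<Rightarrow> 'a set" where
  "neighbours G x = {y. {x, y} \<in> edges G}"

definition add_edge :: "'a set \<Rightarrow> 'a ugraph \<Rightarrow> 'a ugraph" where
  "add_edge e G = (verts G, insert e (edges G))"

text \<open>The notions below are meant for finite connected graphs with at least two vertices. There every
  vertex has a neighbour, so \<^const>\<open>pmf_of_set\<close> is applied to a finite nonempty set; the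
  stationary distribution exists and is unique; first passage times are almost surely finite with
  finite mean, so the series of \<open>mean_first_passage\<close> converges to the expectation.\<close>

definition walk_step :: "'a ugraph \<Rightarrow> 'a \<Rightarrow> 'a pmf" where
  "walk_step G x = pmf_of_set (neighbours G x)"

text \<open>Law of the trajectory \<open>[X\<^sub>0, \<dots>, X\<^sub>n]\<close> of the simple random walk started at \<open>X\<^sub>0 = x\<close>.\<close>

primrec walk_law :: "'a ugraph \<Rightarrow> nat \<Rightarrow> 'a \<Rightarrow> 'a list pmf" where
  "walk_law G 0 x = return_pmf [x]"
| "walk_law G (Suc n) x = bind_pmf (walk_step G x) (\<lambda>y. map_pmf ((#) x) (walk_law G n y))"

text \<open>The probability that \<open>n\<close> is the least positive time at which the walk from \<open>i\<close> is at \<open>j\<close>.\<close>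

definition first_passage_prob :: "'a ugraph \<Rightarrow> 'a \<Rightarrow> 'a \<Rightarrow> nat \<Rightarrow> real" where
  "first_passage_prob G i j n =
     measure_pmf.prob (walk_law G n i) {w. 0 < n \<and> w ! n = j \<and> (\<forall>k. 0 < k \<and> k < n \<longrightarrow> w ! k \<noteq> j)}"

definition mean_first_passage :: "'a ugraph \<Rightarrow> 'a \<Rightarrow> 'a \<Rightarrow> real" where
  "mean_first_passage G i j = (\<Sum>n. real n * first_passage_prob G i j n)"

definition stationary :: "'a ugraph \<Rightarrow> 'a pmf" where
  "stationary G = (THE p. set_pmf p \<subseteq> verts G \<and> bind_pmf p (walk_step G) = p)"

text \<open>The sum does not depend on the starting vertex \<open>i\<close>; Kemeny's constant is the common value.\<close>

definition kemeny :: "'a ugraph \<Rightarrow> real" where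
  "kemeny G = (THE c. \<forall>i \<in> verts G.
     c = (\<Sum>j \<in> verts G - {i}. mean_first_passage G i j * pmf (stationary G) j))"

definition braess_edges :: "'a ugraph \<Rightarrow> 'a set set" where
  "braess_edges G = {{u, v} | u v. u \<in> verts G \<and> v \<in> verts G \<and> u \<noteq> v \<and> {u, v} \<notin> edges G \<and>
     kemeny G < kemeny (add_edge {u, v} G)}"

definition num_braess :: "'a ugraph \<Rightarrow> nat" where
  "num_braess G = card (braess_edges G)"

text \<open>\<open>Leg i k\<close> is the vertex at distance \<open>k \<ge> 1\<close> from the center on the path with index \<open>i\<close>.\<close>

datatype spider_vertex = Center | Leg nat nat

definition spider :: "nat \<Rightarrow> nat \<Rightarrow> spider_vertex ugraph" where
  "spider a b =
     (insert Center {Leg i k | i k. i < b \<and> 1 \<le> k \<and> k \<le> a},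
      {{Center, Leg i 1} | i. i < b \<and> 1 \<le> a} \<union>
      {{Leg i k, Leg i (Suc k)} | i k. i < b \<and> 1 \<le> k \<and> k < a})"

text \<open>Disjoint union of two graphs with \<open>v\<close> and \<open>w\<close> identified; the merged vertex is represented by
  \<open>Inl v\<close>.\<close>

definition identify :: "'a ugraph \<Rightarrow> 'a \<Rightarrow> 'b ugraph \<Rightarrow> 'b \<Rightarrow> ('a + 'b) ugraph" where
  "identify G v H w =
     (let emb = (\<lambda>y. if y = w then Inl v else Inr y)
      in (Inl ` verts G \<union> emb ` verts H, (`) Inl ` edges G \<union> (`) emb ` edges H))"

end

theory Submission
  imports Defs
begin

text \<open>Ground the graph at a vertex \<open>c\<close> and let \<open>g\<close> be the Green kernel of the graph Laplacian
  vanishing at \<open>c\<close>. With degrees \<open>d\<close>, \<open>\<phi>(x) = \<Sum>\<^sub>j d\<^sub>j g(x,j)\<close> and \<open>D = \<Sum>\<^sub>j d\<^sub>j\<close>, the mean hitting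
  time of \<open>j\<close> from \<open>x\<close> is \<open>\<phi>(x) - D g(x,j) - \<phi>(j) + D g(j,j)\<close>; averaging over the stationary law
  \<open>d/D\<close> cancels \<open>\<phi>(x)\<close> and leaves \<open>\<kappa> = \<Sum>\<^sub>j d\<^sub>j g(j,j) - (\<Sum>\<^sub>j d\<^sub>j \<phi>(j))/D\<close>.
  Adding an edge is a rank-one perturbation of the Laplacian, so the Sherman--Morrison formula gives
  the new kernel and hence the change of \<open>\<kappa>\<close>. In the tree at hand, grounded at the center, \<open>g(x,y)\<close> is
  the length of the common part of the paths from the center to \<open>x\<close> and \<open>y\<close>; it vanishes for distinct
  nonadjacent \<open>x\<close>, \<open>y\<close>, so only finitely many numerical cases remain, and \<open>\<kappa>\<close> increases exactly
  for two leaves of the star.\<close>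

section \<open>Degrees and the graph Laplacian\<close>

definition vdeg :: "'a ugraph \<Rightarrow> 'a \<Rightarrow> real" where
  "vdeg H x = real (card (neighbours H x))"

definition laplacian :: "'a ugraph \<Rightarrow> ('a \<Rightarrow> real) \<Rightarrow> 'a \<Rightarrow> real" where
  "laplacian H f x = (\<Sum>y\<in>neighbours H x. f x - f y)"

definition total_degree :: "'a ugraph \<Rightarrow> real" where
  "total_degree H = (\<Sum>x\<in>verts H. vdeg H x)"

lemma neighbours_sym: "y \<in> neighbours H x \<longleftrightarrow> x \<in> neighbours H y"
  by (simp add: neighbours_def insert_commute)

lemma laplacian_diff: "laplacian H (\<lambda>x. f x - g x) x = laplacian H f x - laplacian H g x"
  unfolding laplacian_def sum_subtractf[symmetric] by (rule sum.cong) auto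

lemma laplacian_diff_const: "laplacian H (\<lambda>x. f x - k) x = laplacian H f x"
  by (simp add: laplacian_def)

lemma laplacian_cmult: "laplacian H (\<lambda>x. k * f x) x = k * laplacian H f x"
  by (simp add: laplacian_def sum_distrib_left algebra_simps)

lemma laplacian_sum:
  "laplacian H (\<lambda>x. \<Sum>j\<in>J. f j x) x = (\<Sum>j\<in>J. laplacian H (f j) x)"
  unfolding laplacian_def sum_subtractf[symmetric] by (rule sum.swap)

lemma laplacian_alt: "laplacian H f x = vdeg H x * f x - (\<Sum>y\<in>neighbours H x. f y)"
  by (simp add: laplacian_def vdeg_def sum_subtractf)

lemma neighbours_add_edge:
  "neighbours (add_edge {u, v} H) x
    = neighbours H x \<union> (if x = u then {v} else {}) \<union> (if x = v then {u} else {})"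
  by (auto simp: neighbours_def add_edge_def edges_def doubleton_eq_iff)

lemma verts_add_edge [simp]: "verts (add_edge e H) = verts H"
  by (simp add: add_edge_def verts_def)

lemma walk_law_start: "w \<in> set_pmf (walk_law G n x) \<Longrightarrow> w ! 0 = x"
  by (cases n) auto

section \<open>Graphs grounded at a vertex with a Green kernel\<close>

text \<open>Connectedness is not an axiom: a kernel inverting the Laplacian away from
  \<open>c\<close> forces harmonic functions to be constant. The kernel equation is demanded only
  for \<open>x \<noteq> c\<close>; the equation at \<open>c\<close> is always recovered from the
  fact that a Laplacian sums to zero.\<close>

locale grounded_graph =
  fixes H :: "'a ugraph" and c :: 'a and g :: "'a \<Rightarrow> 'a \<Rightarrow> real"
  assumes finite_verts: "finite (verts H)"
    and edge_verts: "{x, y} \<in> edges H \<Longrightarrow> x \<in> verts H \<and> x \<noteq> y"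
    and neighbours_nonempty: "x \<in> verts H \<Longrightarrow> neighbours H x \<noteq> {}"
    and ground_in_verts: "c \<in> verts H"
    and green_sym: "g x y = g y x"
    and green_ground: "g c y = 0"
    and laplacian_green: "x \<in> verts H \<Longrightarrow> y \<in> verts H \<Longrightarrow> x \<noteq> c \<Longrightarrow>
      laplacian H (\<lambda>z. g z y) x = of_bool (x = y)"
begin

lemma neighbours_verts: "neighbours H x \<subseteq> verts H"
  using edge_verts by (auto simp: neighbours_def insert_commute)

lemma finite_neighbours: "finite (neighbours H x)"
  using neighbours_verts finite_verts by (rule finite_subset)

lemma vdeg_pos: "x \<in> verts H \<Longrightarrow> vdeg H x > 0"
  unfolding vdeg_def using neighbours_nonempty finite_neighbours by (simp add: card_gt_0_iff)

lemma sum_neighbours_swap: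
  "(\<Sum>x\<in>verts H. \<Sum>y\<in>neighbours H x. F x y) = (\<Sum>x\<in>verts H. \<Sum>y\<in>neighbours H x. F y x)"
proof -
  have N: "neighbours H x = {y \<in> verts H. {x, y} \<in> edges H}" for x
    using neighbours_verts by (auto simp: neighbours_def)
  have N': "neighbours H x = {y \<in> verts H. {y, x} \<in> edges H}" for x
    using N by (auto simp: insert_commute)
  show ?thesis
    by (subst (1) N, subst N', rule sum.swap_restrict[OF finite_verts finite_verts])
qed

lemma laplacian_self_adjoint:
  "(\<Sum>x\<in>verts H. f x * laplacian H h x) = (\<Sum>x\<in>verts H. h x * laplacian H f x)"
proof -
  have "(\<Sum>x\<in>verts H. \<Sum>y\<in>neighbours H x. f x * h y)
      = (\<Sum>x\<in>verts H. \<Sum>y\<in>neighbours H x. h x * f y)"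
    by (subst sum_neighbours_swap) (simp add: mult.commute)
  then show ?thesis
    by (simp add: laplacian_alt right_diff_distrib sum_subtractf sum_distrib_left algebra_simps)
qed

lemma sum_laplacian: "(\<Sum>x\<in>verts H. laplacian H f x) = 0"
  using laplacian_self_adjoint[of "\<lambda>_. 1" f] by (simp add: laplacian_def)

text \<open>Pairing with the Green kernel replaces the usual maximum principle on a connected graph.\<close>

lemma harmonic_off_point_constant:
  assumes "j \<in> verts H" "\<And>x. x \<in> verts H \<Longrightarrow> x \<noteq> j \<Longrightarrow> laplacian H f x = 0" "x \<in> verts H"
  shows "f x = f j"
proof -
  \<comment> \<open>The Laplacian sums to zero over all vertices, so one exceptional vertex cannot
    exist: \<open>f\<close> is harmonic at \<open>j\<close> as well.\<close>
  have "(\<Sum>x\<in>verts H. laplacian H f x) = laplacian H f j"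
    using assms finite_verts by (subst sum.remove[of _ j]) auto
  then have harm: "laplacian H f x = 0" if "x \<in> verts H" for x
    using sum_laplacian assms that by (cases "x = j") auto
  have "f y = f c" if y: "y \<in> verts H" for y
  proof -
    \<comment> \<open>Subtracting \<open>f c\<close> makes \<open>h c = 0\<close>, which hides the
      one vertex where the kernel equation is missing.\<close>
    define h where "h = (\<lambda>x. f x - f c)"
    have "(\<Sum>x\<in>verts H. h x * laplacian H (\<lambda>z. g z y) x) = (\<Sum>x\<in>verts H. h x * of_bool (x = y))"
    proof (rule sum.cong)
      show "h x * laplacian H (\<lambda>z. g z y) x = h x * of_bool (x = y)" if "x \<in> verts H" for x
        using laplacian_green[OF that y] by (cases "x = c") (simp_all add: h_def)
    qed simp
    also have "\<dots> = h y"
      using y finite_verts by (simp add: of_bool_def if_distrib if_distribR cong: if_cong)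
    finally have "h y = (\<Sum>x\<in>verts H. g x y * laplacian H h x)"
      by (simp add: laplacian_self_adjoint)
    also have "\<dots> = 0"
      unfolding h_def laplacian_diff_const by (simp add: harm)
    finally show ?thesis by (simp add: h_def)
  qed
  then show ?thesis using assms by metis
qed

lemma total_degree_pos: "total_degree H > 0"
  unfolding total_degree_def using finite_verts ground_in_verts vdeg_pos by (intro sum_pos) auto

section \<open>The stationary distribution\<close>

lemma pmf_walk_step:
  assumes "x \<in> verts H"
  shows "pmf (walk_step H x) y = of_bool (y \<in> neighbours H x) / vdeg H x"
  unfolding walk_step_def vdeg_def
  using neighbours_nonempty[OF assms] finite_neighbours by (simp add: indicator_def of_bool_def)

lemma pmf_bind_walk_step:
  assumes "set_pmf p \<subseteq> verts H"
  shows "pmf (bind_pmf p (walk_step H)) x = (\<Sum>y\<in>neighbours H x. pmf p y / vdeg H y)"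
proof -
  have "pmf (bind_pmf p (walk_step H)) x = (\<Sum>y\<in>verts H. pmf (walk_step H y) x * pmf p y)"
    unfolding pmf_bind using assms finite_verts
    by (subst integral_measure_pmf_real[where A = "verts H"]) auto
  also have "\<dots> = (\<Sum>y\<in>neighbours H x. pmf (walk_step H y) x * pmf p y)"
    using neighbours_verts finite_verts neighbours_sym[of x H] pmf_walk_step
    by (intro sum.mono_neutral_right) simp_all
  also have "\<dots> = (\<Sum>y\<in>neighbours H x. pmf p y / vdeg H y)"
    using neighbours_verts neighbours_sym[of x H] pmf_walk_step
    by (intro sum.cong) (auto simp: subset_iff)
  finally show ?thesis .
qed

text \<open>The definite description calls for existence and uniqueness. Degree weights are
  invariant since each edge then carries mass \<open>1 / total_degree H\<close> in either direction.
  Conversely, an invariant law divided by the degree is harmonic, hence constant, and the total mass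
  fixes the constant.\<close>

lemma pmf_stationary:
  assumes "x \<in> verts H"
  shows "pmf (stationary H) x = vdeg H x / total_degree H"
proof -
  define F where "F x = (if x \<in> verts H then vdeg H x / total_degree H else 0)" for x
  have F_nonneg: "0 \<le> F x" for x
    using total_degree_pos by (simp add: F_def vdeg_def)
  have F_sum: "(\<Sum>x\<in>verts H. F x) = 1"
    using total_degree_pos by (simp add: F_def sum_divide_distrib[symmetric] total_degree_def[symmetric])
  have "(\<integral>\<^sup>+x. ennreal (F x) \<partial>count_space UNIV) = (\<Sum>x\<in>verts H. ennreal (F x))"
    using finite_verts by (rule nn_integral_count_space') (simp_all add: F_def)
  also have "\<dots> = 1"
    using F_nonneg by (simp add: sum_ennreal F_sum)
  finally have "(\<integral>\<^sup>+x. ennreal (F x) \<partial>count_space UNIV) = 1" .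
  note F_pmf = pmf_embed_pmf[of F, OF F_nonneg this]
  define P where "P = embed_pmf F"
  have pmf_P: "pmf P x = F x" for x using F_pmf by (simp add: P_def)
  have set_P: "set_pmf P \<subseteq> verts H"
    by (auto simp: set_pmf_eq pmf_P F_def split: if_splits)
  have "pmf (bind_pmf P (walk_step H)) x = pmf P x" for x
  proof -
    have "pmf (bind_pmf P (walk_step H)) x = (\<Sum>y\<in>neighbours H x. 1 / total_degree H)"
      unfolding pmf_bind_walk_step[OF set_P] using neighbours_verts vdeg_pos
      by (intro sum.cong) (auto simp: pmf_P F_def subset_iff less_imp_neq[symmetric])
    also have "\<dots> = pmf P x"
    proof -
      \<comment> \<open>Invariance must hold on the whole type; off the vertex set both sides
        vanish.\<close>
      have "neighbours H x = {}" if "x \<notin> verts H"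
        using edge_verts that by (auto simp: neighbours_def)
      then show ?thesis by (auto simp: pmf_P F_def vdeg_def)
    qed
    finally show ?thesis .
  qed
  then have inv_P: "bind_pmf P (walk_step H) = P" by (rule pmf_eqI)
  have unique: "q = P" if q: "set_pmf q \<subseteq> verts H \<and> bind_pmf q (walk_step H) = q" for q
  proof -
    define f where "f y = pmf q y / vdeg H y" for y
    have "laplacian H f y = 0" if "y \<in> verts H" for y
      using pmf_bind_walk_step[of q y] q vdeg_pos[OF that]
      by (simp add: laplacian_alt f_def)
    then have fc: "f y = f c" if "y \<in> verts H" for y
      using harmonic_off_point_constant[of c f y] ground_in_verts that by auto
    have qv: "pmf q y = f c * vdeg H y" if "y \<in> verts H" for y
      using fc[OF that] vdeg_pos[OF that] by (simp add: f_def field_simps)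
    have "1 = (\<Sum>y\<in>verts H. pmf q y)"
      using sum_pmf_eq_1[OF finite_verts] q by simp
    also have "\<dots> = f c * total_degree H"
      by (simp add: qv total_degree_def sum_distrib_left)
    finally have "f c = 1 / total_degree H" using total_degree_pos by (simp add: field_simps)
    then have "pmf q y = pmf P y" for y
      using qv q by (cases "y \<in> verts H") (auto simp: pmf_P F_def set_pmf_eq)
    then show ?thesis by (rule pmf_eqI)
  qed
  have "stationary H = P"
    unfolding stationary_def
    by (rule the_equality) (fact conjI[OF set_P inv_P], fact unique)
  then show ?thesis using assms by (simp add: pmf_P F_def)
qed

section \<open>First-step decomposition of first passage\<close>

lemma prob_bind_walk_step:
  assumes "x \<in> verts H"
  shows "measure_pmf.prob (bind_pmf (walk_step H x) F) A
    = (\<Sum>y\<in>neighbours H x. measure_pmf.prob (F y) A) / vdeg H x"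
proof -
  have "measure_pmf.prob (bind_pmf (walk_step H x) F) A
      = (\<integral>y. measure_pmf.prob (F y) A \<partial>walk_step H x)"
    unfolding measure_pmf_bind
    by (rule measure_pmf.measure_bind[where N = "count_space UNIV"])
      (auto simp: space_subprob_algebra intro: prob_space_imp_subprob_space measure_pmf.prob_space_axioms)
  also have "\<dots> = (\<Sum>y\<in>neighbours H x. measure_pmf.prob (F y) A * pmf (walk_step H x) y)"
    using finite_neighbours neighbours_nonempty[OF assms]
    by (intro integral_measure_pmf_real) (auto simp: walk_step_def)
  also have "\<dots> = (\<Sum>y\<in>neighbours H x. measure_pmf.prob (F y) A) / vdeg H x"
    unfolding sum_divide_distrib by (rule sum.cong) (simp_all add: pmf_walk_step[OF assms])
  finally show ?thesis .
qed

text \<open>Condition on the first step. A step to \<open>j\<close> ends the passage, so that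
  neighbour contributes only for \<open>n = 0\<close>; \<open>first_passage_prob H j j n\<close>
  would instead describe a return to \<open>j\<close>.\<close>

lemma first_passage_prob_Suc:
  assumes "x \<in> verts H"
  shows "first_passage_prob H x j (Suc n)
    = (\<Sum>y\<in>neighbours H x. if y = j then of_bool (n = 0) else first_passage_prob H y j n) / vdeg H x"
proof -
  \<comment> \<open>After the first step is removed, time 0 of the remaining walk was a positive
    time, so \<open>B\<close> forbids \<open>j\<close> there too.\<close>
  define B where "B = {w. w ! n = j \<and> (\<forall>k<n. w ! k \<noteq> j)}"
  have "(#) x -` {w. 0 < Suc n \<and> w ! Suc n = j \<and> (\<forall>k. 0 < k \<and> k < Suc n \<longrightarrow> w ! k \<noteq> j)} = B"
    by (auto simp: B_def gr0_conv_Suc)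
  then have "first_passage_prob H x j (Suc n)
      = (\<Sum>y\<in>neighbours H x. measure_pmf.prob (walk_law H n y) B) / vdeg H x"
    unfolding first_passage_prob_def walk_law.simps
    by (subst prob_bind_walk_step[OF assms]) simp
  moreover have "measure_pmf.prob (walk_law H n y) B
      = (if y = j then of_bool (n = 0) else first_passage_prob H y j n)" for y
  proof (cases "n = 0")
    case True
    then show ?thesis by (auto simp: B_def first_passage_prob_def)
  next
    case n: False
    show ?thesis
    proof (cases "y = j")
      case True
      then have "measure_pmf.prob (walk_law H n y) B = 0"
        using n walk_law_start[of _ H n y] by (auto simp: measure_pmf_zero_iff B_def)
      then show ?thesis using True n by simp
    next
      case False
      \<comment> \<open>The extra condition at time 0 holds almost surely because the walk starts at
        \<open>y \<noteq> j\<close>.\<close>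
      have "measure_pmf.prob (walk_law H n y) B = first_passage_prob H y j n"
        unfolding first_passage_prob_def
        using False n walk_law_start[of _ H n y]
        by (intro measure_pmf.finite_measure_eq_AE) (auto simp: AE_measure_pmf_iff B_def, metis gr0I)
      then show ?thesis using False by simp
    qed
  qed
  ultimately show ?thesis by simp
qed

section \<open>Hitting times from the Green kernel\<close>

definition potential :: "'a \<Rightarrow> real" where
  "potential x = (\<Sum>j\<in>verts H. vdeg H j * g x j)"

text \<open>The target comes first, so that \<open>hitting_time j\<close> is a function of the
  start; the bracket normalises it to vanish at \<open>j\<close>.\<close>

definition hitting_time :: "'a \<Rightarrow> 'a \<Rightarrow> real" where
  "hitting_time j x = potential x - total_degree H * g x j - (potential j - total_degree H * g j j)"

lemma laplacian_potential:
  assumes "x \<in> verts H" "x \<noteq> c"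
  shows "laplacian H potential x = vdeg H x"
proof -
  have "laplacian H potential x = (\<Sum>j\<in>verts H. vdeg H j * of_bool (x = j))"
    unfolding potential_def[abs_def] laplacian_sum laplacian_cmult
    using assms laplacian_green by (intro sum.cong) auto
  also have "\<dots> = vdeg H x"
    using assms finite_verts by (simp add: of_bool_def if_distrib cong: if_cong)
  finally show ?thesis .
qed

text \<open>This is the first-step equation for expected hitting times, multiplied by the
  degree.\<close>

lemma laplacian_hitting_time:
  assumes j: "j \<in> verts H" and x: "x \<in> verts H" "x \<noteq> j"
  shows "laplacian H (hitting_time j) x = vdeg H x"
proof -
  \<comment> \<open>\<open>D\<close> is the defect of the equation, with a point mass at
    \<open>j\<close> that balances the total degree. It vanishes off \<open>c\<close> by the kernel
    equation and sums to zero, so it vanishes at \<open>c\<close> too.\<close>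
  define D where "D z = laplacian H (hitting_time j) z - vdeg H z + total_degree H * of_bool (z = j)" for z
  have D0: "D z = 0" if "z \<in> verts H" "z \<noteq> c" for z
    using that j unfolding D_def hitting_time_def[abs_def] laplacian_diff_const laplacian_diff laplacian_cmult
    by (simp add: laplacian_potential laplacian_green)
  have "(\<Sum>z\<in>verts H. D z) = 0"
    using j finite_verts unfolding D_def sum.distrib sum_subtractf sum_laplacian
    by (simp add: total_degree_def[symmetric] sum_distrib_left[symmetric] of_bool_def)
  moreover have "(\<Sum>z\<in>verts H. D z) = D c"
    using D0 finite_verts ground_in_verts by (subst sum.remove[of _ c]) auto
  ultimately have "D x = 0"
    using D0 x by (cases "x = c") auto
  then show ?thesis using x by (simp add: D_def)
qed

text \<open>Minimum principle: the Laplacian is at most 0 at a minimum but positive off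
  \<open>j\<close>, so the minimum is at \<open>j\<close>, where the value is 0.\<close>

lemma hitting_time_nonneg:
  assumes j: "j \<in> verts H" and x: "x \<in> verts H"
  shows "hitting_time j x \<ge> 0"
proof -
  obtain z where z: "z \<in> verts H" and min: "\<And>y. y \<in> verts H \<Longrightarrow> hitting_time j z \<le> hitting_time j y"
    using ex_min_if_finite[of "hitting_time j ` verts H"] finite_verts j by (force simp: not_less)
  have "z = j"
  proof (rule ccontr)
    assume "z \<noteq> j"
    then have "0 < laplacian H (hitting_time j) z"
      using laplacian_hitting_time[OF j z] vdeg_pos[OF z] by simp
    moreover have "laplacian H (hitting_time j) z \<le> 0"
      unfolding laplacian_def using min neighbours_verts by (intro sum_nonpos) (auto simp: subset_iff)
    ultimately show False by simp
  qed
  moreover have "hitting_time j j = 0" by (simp add: hitting_time_def)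
  ultimately show ?thesis using min[OF x] by simp
qed

text \<open>Inductive bounds on the truncated sums first give convergence of the series. Their
  limits then satisfy first-step equations, whose solutions are determined by the value at
  \<open>j\<close>.\<close>

lemma mean_first_passage_eq:
  assumes j: "j \<in> verts H" and i: "i \<in> verts H" "i \<noteq> j"
  shows "mean_first_passage H i j = hitting_time j i"
proof -
  define f where "f n y = first_passage_prob H y j n" for n y
  have f_nonneg: "f n y \<ge> 0" for n y by (simp add: f_def first_passage_prob_def)
  have f_0: "f 0 y = 0" for y by (simp add: f_def first_passage_prob_def)
  have f_Suc: "f (Suc n) y = (\<Sum>z\<in>neighbours H y. if z = j then of_bool (n = 0) else f n z) / vdeg H y"
    if "y \<in> verts H" for n y
    unfolding f_def by (rule first_passage_prob_Suc[OF that])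
  have nv: "z \<in> verts H" if "z \<in> neighbours H y" for z y
    using neighbours_verts that by blast

  have F_le: "(\<Sum>n<N. f n y) \<le> 1" if "y \<in> verts H" for N y
    using that
  proof (induction N arbitrary: y)
    case (Suc N)
    have "(\<Sum>n<Suc N. f n y)
        = (\<Sum>z\<in>neighbours H y. \<Sum>n<N. if z = j then of_bool (n = 0) else f n z) / vdeg H y"
      unfolding sum.lessThan_Suc_shift
      by (subst sum.swap) (simp add: f_0 f_Suc[OF Suc.prems] sum_divide_distrib)
    also have "\<dots> \<le> (\<Sum>z\<in>neighbours H y. 1) / vdeg H y"
    proof (intro divide_right_mono sum_mono)
      fix z assume z: "z \<in> neighbours H y"
      have "(\<Sum>n<N. of_bool (n = 0)) \<le> (1 :: real)" by (simp add: of_bool_def)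
      then show "(\<Sum>n<N. if z = j then of_bool (n = 0) else f n z) \<le> 1"
        using Suc.IH[OF nv[OF z]] by (cases "z = j") simp_all
    qed (use vdeg_pos[OF Suc.prems] in simp)
    also have "\<dots> = 1" using vdeg_pos[OF Suc.prems] by (simp add: vdeg_def)
    finally show ?case .
  qed simp

  have hit_avg: "(\<Sum>z\<in>neighbours H y. hitting_time j z + 1) / vdeg H y = hitting_time j y"
    if "y \<in> verts H" "y \<noteq> j" for y
    using laplacian_hitting_time[OF j that] vdeg_pos[OF that(1)]
    by (simp add: laplacian_alt sum.distrib vdeg_def[symmetric] field_simps)
  \<comment> \<open>\<open>hitting_time j\<close> dominates every truncated expectation: writing the
    weight \<open>n + 1\<close> as \<open>n\<close> plus 1, the first part is bounded by induction
    and the second by \<open>F_le\<close>.\<close>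
  have M_le: "(\<Sum>n<N. real n * f n y) \<le> hitting_time j y" if "y \<in> verts H" "y \<noteq> j" for N y
    using that
  proof (induction N arbitrary: y)
    case 0
    then show ?case using hitting_time_nonneg[OF j] by simp
  next
    case (Suc N)
    have "(\<Sum>n<Suc N. real n * f n y) = (\<Sum>z\<in>neighbours H y. \<Sum>n<N.
        real (Suc n) * (if z = j then of_bool (n = 0) else f n z)) / vdeg H y"
      unfolding sum.lessThan_Suc_shift
      by (subst sum.swap) (simp add: f_0 f_Suc[OF Suc.prems(1)] sum_divide_distrib sum_distrib_left)
    also have "\<dots> \<le> (\<Sum>z\<in>neighbours H y. hitting_time j z + 1) / vdeg H y"
    proof (intro divide_right_mono sum_mono)
      fix z assume z: "z \<in> neighbours H y"
      show "(\<Sum>n<N. real (Suc n) * (if z = j then of_bool (n = 0) else f n z)) \<le> hitting_time j z + 1"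
      proof (cases "z = j")
        case True
        have "(\<Sum>n<N. real (Suc n) * of_bool (n = 0)) = (\<Sum>n<N. if n = 0 then 1 else 0)"
          by (rule sum.cong) auto
        also have "\<dots> \<le> (1 :: real)" by simp
        finally show ?thesis using True hitting_time_nonneg[OF j j] by simp
      next
        case False
        then show ?thesis
          using Suc.IH[OF nv[OF z]] F_le[OF nv[OF z], of N]
          by (simp add: algebra_simps sum.distrib)
      qed
    qed (use vdeg_pos[OF Suc.prems(1)] in simp)
    finally show ?case using hit_avg[OF Suc.prems] by simp
  qed

  define Fs where "Fs y = (\<Sum>n. f n y)" for y
  define Ms where "Ms y = (\<Sum>n. real n * f n y)" for y
  have Fs: "(\<lambda>n. f n y) sums Fs y" if "y \<in> verts H" for y
    unfolding Fs_def using F_le[OF that] f_nonneg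
    by (intro summable_sums summableI_nonneg_bounded)
  have Ms: "(\<lambda>n. real n * f n y) sums Ms y" if "y \<in> verts H" "y \<noteq> j" for y
    unfolding Ms_def using M_le[OF that] f_nonneg
    by (intro summable_sums summableI_nonneg_bounded) auto
  have single: "(\<lambda>n. real (Suc n) * of_bool (n = 0)) sums 1" "(\<lambda>n. of_bool (n = (0::nat))) sums (1 :: real)"
    using sums_single[of 0 "\<lambda>_. 1 :: real"] by (simp_all add: of_bool_def if_distrib cong: if_cong)

  \<comment> \<open>\<open>e\<close> is the probability of ever reaching \<open>j\<close>, counted
    as 1 at \<open>j\<close> itself, where \<open>Fs j\<close> would be a return probability. It is
    harmonic off \<open>j\<close>, hence identically 1: the walk is recurrent.\<close>
  define e where "e y = (if y = j then 1 else Fs y)" for y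
  have "laplacian H e y = 0" if y: "y \<in> verts H" "y \<noteq> j" for y
  proof -
    have "(\<lambda>n. f (Suc n) y) sums ((\<Sum>z\<in>neighbours H y. e z) / vdeg H y)"
      unfolding f_Suc[OF y(1)] e_def using single(2) Fs[OF nv]
      by (intro sums_divide sums_sum) auto
    then have "(\<lambda>n. f n y) sums ((\<Sum>z\<in>neighbours H y. e z) / vdeg H y)"
      using sums_Suc[of "\<lambda>n. f n y"] f_0 by fastforce
    then have "e y = (\<Sum>z\<in>neighbours H y. e z) / vdeg H y"
      using sums_unique2[OF Fs[OF y(1)]] y by (simp add: e_def)
    then show ?thesis using vdeg_pos[OF y(1)] by (simp add: laplacian_alt field_simps)
  qed
  then have "e y = e j" if "y \<in> verts H" for y
    using harmonic_off_point_constant[OF j, of e] that by blast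
  then have Fs1: "Fs y = 1" if "y \<in> verts H" "y \<noteq> j" for y
    using that by (force simp: e_def)

  \<comment> \<open>The value at \<open>j\<close> is set to 0, in place of the mean return time.
    Then \<open>t\<close> and \<open>hitting_time j\<close> solve the same equation off
    \<open>j\<close> and agree at \<open>j\<close>.\<close>
  define t where "t y = (if y = j then 0 else Ms y)" for y
  have "laplacian H t y = vdeg H y" if y: "y \<in> verts H" "y \<noteq> j" for y
  proof -
    have "(\<lambda>n. real (Suc n) * (if z = j then of_bool (n = 0) else f n z)) sums (t z + 1)"
      if z: "z \<in> neighbours H y" for z
    proof (cases "z = j")
      case True
      then show ?thesis using single(1) by (simp add: t_def)
    next
      case False
      then show ?thesis
        using sums_add[OF Ms[OF nv[OF z]] Fs[OF nv[OF z]]] Fs1[OF nv[OF z]]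
        by (simp add: t_def algebra_simps)
    qed
    then have "(\<lambda>n. (\<Sum>z\<in>neighbours H y. real (Suc n) * (if z = j then of_bool (n = 0) else f n z)) / vdeg H y)
        sums ((\<Sum>z\<in>neighbours H y. t z + 1) / vdeg H y)"
      by (intro sums_divide sums_sum)
    then have "(\<lambda>n. real (Suc n) * f (Suc n) y) sums ((\<Sum>z\<in>neighbours H y. t z + 1) / vdeg H y)"
      by (simp add: f_Suc[OF y(1)] sum_distrib_left)
    then have "(\<lambda>n. real n * f n y) sums ((\<Sum>z\<in>neighbours H y. t z + 1) / vdeg H y)"
      using sums_Suc[of "\<lambda>n. real n * f n y"] by fastforce
    then have "t y = (\<Sum>z\<in>neighbours H y. t z + 1) / vdeg H y"
      using sums_unique2[OF Ms[OF y]] y by (simp add: t_def)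
    then show ?thesis
      using vdeg_pos[OF y(1)] by (simp add: laplacian_alt sum.distrib vdeg_def[symmetric] field_simps)
  qed
  then have "t i - hitting_time j i = t j - hitting_time j j"
    using laplacian_hitting_time[OF j]
    by (intro harmonic_off_point_constant[OF j, of "\<lambda>x. t x - hitting_time j x"] i)
      (simp add: laplacian_diff)
  then show ?thesis
    using i by (simp add: t_def Ms_def f_def hitting_time_def mean_first_passage_def)
qed

section \<open>Kemeny's constant through the Green kernel\<close>

theorem kemeny_eq:
  "kemeny H = (\<Sum>j\<in>verts H. vdeg H j * g j j)
     - (\<Sum>j\<in>verts H. vdeg H j * potential j) / total_degree H"
proof -
  let ?c = "(\<Sum>j\<in>verts H. vdeg H j * g j j)
     - (\<Sum>j\<in>verts H. vdeg H j * potential j) / total_degree H"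
  have V: "total_degree H \<noteq> 0" using total_degree_pos by simp
  have "(\<Sum>j\<in>verts H - {i}. mean_first_passage H i j * pmf (stationary H) j) = ?c"
    if i: "i \<in> verts H" for i
  proof -
    have "(\<Sum>j\<in>verts H - {i}. mean_first_passage H i j * pmf (stationary H) j)
        = (\<Sum>j\<in>verts H - {i}. hitting_time j i * (vdeg H j / total_degree H))"
      using i by (intro sum.cong) (auto simp: mean_first_passage_eq pmf_stationary)
    \<comment> \<open>The term \<open>j = i\<close> can be included since
      \<open>hitting_time i i = 0\<close>.\<close>
    also have "\<dots> = (\<Sum>j\<in>verts H. hitting_time j i * (vdeg H j / total_degree H))"
      using i finite_verts by (subst (2) sum.remove[of _ i]) (auto simp: hitting_time_def)
    also have "\<dots> = (\<Sum>j\<in>verts H. vdeg H j * potential i / total_degree H - vdeg H j * g i j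
        - vdeg H j * potential j / total_degree H + vdeg H j * g j j)"
      using V by (intro sum.cong) (auto simp: hitting_time_def field_simps)
    also have "\<dots> = total_degree H * potential i / total_degree H - potential i
        - (\<Sum>j\<in>verts H. vdeg H j * potential j) / total_degree H + (\<Sum>j\<in>verts H. vdeg H j * g j j)"
      by (simp add: sum.distrib sum_subtractf sum_divide_distrib sum_distrib_right
          total_degree_def potential_def)
    also have "\<dots> = ?c" using V by simp
    finally show ?thesis .
  qed
  then show ?thesis
    unfolding kemeny_def using ground_in_verts by (intro the_equality) auto
qed

section \<open>The effect of adding an edge\<close>

context
  fixes u v :: 'a
  assumes u: "u \<in> verts H" and v: "v \<in> verts H" and uv: "u \<noteq> v" "{u, v} \<notin> edges H"
begin

lemma not_neighbours: "v \<notin> neighbours H u" "u \<notin> neighbours H v"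
  using uv by (auto simp: neighbours_def insert_commute)

lemma vdeg_add_edge: "vdeg (add_edge {u, v} H) x = vdeg H x + of_bool (x = u) + of_bool (x = v)"
  using uv not_neighbours finite_neighbours by (simp add: vdeg_def neighbours_add_edge)

lemma laplacian_add_edge:
  "laplacian (add_edge {u, v} H) f x
    = laplacian H f x + (of_bool (x = u) - of_bool (x = v)) * (f u - f v)"
  using uv not_neighbours finite_neighbours by (simp add: laplacian_def neighbours_add_edge)

lemma total_degree_add_edge: "total_degree (add_edge {u, v} H) = total_degree H + 2"
  using u v finite_verts by (simp add: total_degree_def vdeg_add_edge sum.distrib of_bool_def)

text \<open>The potential of a unit current flowing between \<open>u\<close> and \<open>v\<close>,
  grounded at \<open>c\<close>: its Laplacian off \<open>c\<close> is the difference of the point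
  masses at \<open>u\<close> and \<open>v\<close>.\<close>

definition voltage :: "'a \<Rightarrow> real" where
  "voltage x = g x u - g x v"

text \<open>The effective resistance between \<open>u\<close> and \<open>v\<close>, equal to
  \<open>voltage u - voltage v\<close>.\<close>

definition resistance :: real where
  "resistance = g u u + g v v - 2 * g u v"

text \<open>The Sherman--Morrison update of the Green kernel.\<close>

lemma grounded_graph_add_edge:
  assumes "1 + resistance \<noteq> 0"
  shows "grounded_graph (add_edge {u, v} H) c (\<lambda>x y. g x y - voltage x * voltage y / (1 + resistance))"
proof
  show "finite (verts (add_edge {u, v} H))" using finite_verts by simp
  show "x \<in> verts (add_edge {u, v} H) \<and> x \<noteq> y" if "{x, y} \<in> edges (add_edge {u, v} H)" for x y
    using that edge_verts[of x y] u v uv by (auto simp: add_edge_def edges_def verts_def doubleton_eq_iff)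
  show "neighbours (add_edge {u, v} H) x \<noteq> {}" if "x \<in> verts (add_edge {u, v} H)" for x
    using neighbours_nonempty that by (auto simp: neighbours_add_edge)
  show "c \<in> verts (add_edge {u, v} H)" using ground_in_verts by simp
  show "g x y - voltage x * voltage y / (1 + resistance) = g y x - voltage y * voltage x / (1 + resistance)" for x y
    by (simp add: green_sym[of x y] mult.commute)
  show "g c y - voltage c * voltage y / (1 + resistance) = 0" for y
    by (simp add: voltage_def green_ground)
  show "laplacian (add_edge {u, v} H) (\<lambda>z. g z y - voltage z * voltage y / (1 + resistance)) x = of_bool (x = y)"
    if x: "x \<in> verts (add_edge {u, v} H)" "x \<noteq> c" and y: "y \<in> verts (add_edge {u, v} H)" for x y
  proof -
    let ?k = "voltage y / (1 + resistance)" and ?d = "of_bool (x = u) - of_bool (x = v) :: real"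
    have "laplacian H voltage x = ?d"
      unfolding voltage_def[abs_def] laplacian_diff using x u v by (simp add: laplacian_green)
    then have H: "laplacian H (\<lambda>z. g z y - ?k * voltage z) x = of_bool (x = y) - ?k * ?d"
      using x y unfolding laplacian_diff laplacian_cmult by (simp add: laplacian_green)
    have resistance: "voltage u - voltage v = resistance"
      by (simp add: voltage_def resistance_def green_sym[of v u])
    have jump: "g u y - ?k * voltage u - (g v y - ?k * voltage v) = voltage y - ?k * resistance"
      unfolding resistance[symmetric] right_diff_distrib by (simp add: voltage_def green_sym[of y])
    have "laplacian (add_edge {u, v} H) (\<lambda>z. g z y - ?k * voltage z) x
        = of_bool (x = y) - ?k * ?d + ?d * (voltage y - ?k * resistance)"
      unfolding laplacian_add_edge H jump ..
    \<comment> \<open>By the choice of \<open>?k\<close>, \<open>?k * (1 + resistance)\<close> is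
      \<open>voltage y\<close>. So the current through the new edge is exactly \<open>?k\<close> and
      cancels the term \<open>?k * ?d\<close>.\<close>
    also have "voltage y - ?k * resistance = ?k"
      using assms by (simp add: divide_simps) (simp add: algebra_simps)
    finally show ?thesis by (simp add: mult.commute)
  qed
qed

text \<open>\<open>kemeny_eq\<close> is applied to the updated kernel. The rank-one correction
  enters the double sum as the square of the degree-weighted total of \<open>voltage\<close>, which
  \<open>flux\<close> evaluates through the symmetry of \<open>g\<close>.\<close>

lemma kemeny_add_edge:
  assumes R: "1 + resistance \<noteq> 0"
  shows "kemeny (add_edge {u, v} H) =
    (\<Sum>j\<in>verts H. vdeg H j * g j j) + g u u + g v v
      - ((\<Sum>j\<in>verts H. vdeg H j * (voltage j)\<^sup>2) + (voltage u)\<^sup>2 + (voltage v)\<^sup>2) / (1 + resistance)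
      - ((\<Sum>j\<in>verts H. vdeg H j * potential j) + 2 * (potential u + potential v)
           + g u u + g v v + 2 * g u v
           - (potential u - potential v + voltage u + voltage v)\<^sup>2 / (1 + resistance)) / (total_degree H + 2)"
proof -
  let ?H = "add_edge {u, v} H" and ?r = "1 + resistance"
  interpret H': grounded_graph ?H c "\<lambda>x y. g x y - voltage x * voltage y / ?r"
    using R by (rule grounded_graph_add_edge)
  have sum': "(\<Sum>j\<in>verts H. vdeg ?H j * f j) = (\<Sum>j\<in>verts H. vdeg H j * f j) + f u + f v" for f
  proof -
    have point: "of_bool (j = z) * f j = (if j = z then f j else 0)" for j z by simp
    show ?thesis
      unfolding vdeg_add_edge distrib_right sum.distrib point using u v finite_verts by simp
  qed
  have pot_sym: "potential x = (\<Sum>j\<in>verts H. vdeg H j * g j x)" for x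
    unfolding potential_def by (intro sum.cong refl arg_cong[where f = "(*) _"] green_sym)
  have flux: "(\<Sum>j\<in>verts H. vdeg ?H j * voltage j) = potential u - potential v + voltage u + voltage v"
    unfolding sum' pot_sym by (simp add: voltage_def right_diff_distrib sum_subtractf)
  have pot': "H'.potential x = potential x + g x u + g x v
      - voltage x * (potential u - potential v + voltage u + voltage v) / ?r" for x
  proof -
    have "H'.potential x = (\<Sum>j\<in>verts H. vdeg ?H j * g x j) - voltage x * (\<Sum>j\<in>verts H. vdeg ?H j * voltage j) / ?r"
      unfolding H'.potential_def verts_add_edge
      by (simp add: right_diff_distrib sum_subtractf sum_distrib_left sum_divide_distrib ac_simps)
    then show ?thesis unfolding flux sum' by (simp add: potential_def)
  qed
  have "(\<Sum>j\<in>verts H. vdeg ?H j * H'.potential j)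
      = (\<Sum>j\<in>verts H. vdeg ?H j * (potential j + g j u + g j v))
        - (\<Sum>j\<in>verts H. vdeg ?H j * voltage j) * (potential u - potential v + voltage u + voltage v) / ?r"
    unfolding pot' by (simp add: right_diff_distrib sum_subtractf sum_distrib_right sum_divide_distrib ac_simps)
  also have "(\<Sum>j\<in>verts H. vdeg ?H j * (potential j + g j u + g j v))
      = (\<Sum>j\<in>verts H. vdeg H j * potential j) + 2 * (potential u + potential v) + g u u + g v v + 2 * g u v"
  proof -
    have "(\<Sum>j\<in>verts H. vdeg H j * (potential j + g j u + g j v))
       = (\<Sum>j\<in>verts H. vdeg H j * potential j) + potential u + potential v"
      unfolding pot_sym[of u] pot_sym[of v] by (simp add: distrib_left sum.distrib)
    then show ?thesis unfolding sum' by (simp add: green_sym[of v u])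
  qed
  finally have pots: "(\<Sum>j\<in>verts H. vdeg ?H j * H'.potential j)
      = (\<Sum>j\<in>verts H. vdeg H j * potential j) + 2 * (potential u + potential v) + g u u + g v v + 2 * g u v
         - (potential u - potential v + voltage u + voltage v)\<^sup>2 / ?r"
    unfolding flux by (simp add: power2_eq_square)
  have "(\<Sum>j\<in>verts H. vdeg ?H j * (g j j - voltage j * voltage j / ?r))
      = (\<Sum>j\<in>verts H. vdeg ?H j * g j j) - (\<Sum>j\<in>verts H. vdeg ?H j * (voltage j)\<^sup>2) / ?r"
    by (simp add: right_diff_distrib sum_subtractf sum_divide_distrib power2_eq_square)
  then show ?thesis
    unfolding H'.kemeny_eq verts_add_edge pots total_degree_add_edge unfolding sum' by simp
qed

text \<open>When \<open>u\<close> and \<open>v\<close> lie in different blocks at the ground, the change involves only data of the two blocks.\<close>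

lemma kemeny_add_edge_separated:
  assumes sep: "\<And>j. j \<in> verts H \<Longrightarrow> g j u * g j v = 0" and guv: "g u v = 0"
    and R: "1 + g u u + g v v \<noteq> 0"
  shows "kemeny (add_edge {u, v} H) - kemeny H =
    g u u + g v v
      - ((\<Sum>j\<in>verts H. vdeg H j * (g j u)\<^sup>2) + (\<Sum>j\<in>verts H. vdeg H j * (g j v)\<^sup>2)
          + (g u u)\<^sup>2 + (g v v)\<^sup>2) / (1 + g u u + g v v)
      + (\<Sum>j\<in>verts H. vdeg H j * potential j) / total_degree H
      - ((\<Sum>j\<in>verts H. vdeg H j * potential j) + 2 * (potential u + potential v) + g u u + g v v
           - (potential u - potential v + g u u - g v v)\<^sup>2 / (1 + g u u + g v v))
        / (total_degree H + 2)"
proof -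
  \<comment> \<open>The cross term of the square vanishes by \<open>sep\<close>.\<close>
  have "vdeg H j * (voltage j)\<^sup>2 = vdeg H j * (g j u)\<^sup>2 + vdeg H j * (g j v)\<^sup>2" if "j \<in> verts H" for j
    using sep[OF that] by (auto simp: voltage_def)
  then have "(\<Sum>j\<in>verts H. vdeg H j * (voltage j)\<^sup>2)
      = (\<Sum>j\<in>verts H. vdeg H j * (g j u)\<^sup>2) + (\<Sum>j\<in>verts H. vdeg H j * (g j v)\<^sup>2)"
    by (simp add: sum.distrib)
  moreover have "voltage u = g u u" "voltage v = - g v v" "1 + resistance = 1 + g u u + g v v"
    using guv by (simp_all add: voltage_def resistance_def green_sym[of v u])
  ultimately show ?thesis
    using kemeny_add_edge R guv by (simp add: kemeny_eq add.assoc)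
qed

end

end

section \<open>The star and the spider joined at their centers\<close>

definition star_spider :: "nat \<Rightarrow> nat \<Rightarrow> (spider_vertex + spider_vertex) ugraph" where
  "star_spider b1 b2 = identify (spider 1 b1) Center (spider 2 b2) Center"

abbreviation hub :: "spider_vertex + spider_vertex" where "hub \<equiv> Inl Center"
abbreviation leaf :: "nat \<Rightarrow> spider_vertex + spider_vertex" where "leaf i \<equiv> Inl (Leg i (Suc 0))"
abbreviation mid :: "nat \<Rightarrow> spider_vertex + spider_vertex" where "mid i \<equiv> Inr (Leg i (Suc 0))"
abbreviation tip :: "nat \<Rightarrow> spider_vertex + spider_vertex" where "tip i \<equiv> Inr (Leg i 2)"

lemma verts_star_spider:
  "verts (star_spider b1 b2) = insert hub (leaf ` {..<b1} \<union> mid ` {..<b2} \<union> tip ` {..<b2})"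
proof -
  have legs: "{Leg i k |i k. i < b \<and> 1 \<le> k \<and> k \<le> 1} = (\<lambda>i. Leg i 1) ` {..<b}"
    "{Leg i k |i k. i < b \<and> 1 \<le> k \<and> k \<le> 2} = (\<lambda>i. Leg i 1) ` {..<b} \<union> (\<lambda>i. Leg i 2) ` {..<b}" for b
    by (auto simp: le_Suc_eq numeral_2_eq_2)
  show ?thesis
    unfolding star_spider_def identify_def spider_def Let_def verts_def edges_def fst_conv legs
    by (auto simp: image_image image_Un)
qed

lemma edges_star_spider:
  "edges (star_spider b1 b2) = (\<lambda>i. {hub, leaf i}) ` {..<b1} \<union> (\<lambda>i. {hub, mid i}) ` {..<b2}
     \<union> (\<lambda>i. {mid i, tip i}) ` {..<b2}"
proof -
  have legs: "{{Center, Leg i 1} |i. i < b \<and> (1::nat) \<le> 1} = (\<lambda>i. {Center, Leg i 1}) ` {..<b}"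
    "{{Center, Leg i 1} |i. i < b \<and> (1::nat) \<le> 2} = (\<lambda>i. {Center, Leg i 1}) ` {..<b}"
    "{{Leg i k, Leg i (Suc k)} |i k. i < b \<and> 1 \<le> k \<and> k < 1} = {}"
    "{{Leg i k, Leg i (Suc k)} |i k. i < b \<and> 1 \<le> k \<and> k < 2} = (\<lambda>i. {Leg i 1, Leg i 2}) ` {..<b}" for b
    by (auto simp: less_Suc_eq numeral_2_eq_2 image_def)
  show ?thesis
    unfolding star_spider_def identify_def spider_def Let_def verts_def edges_def snd_conv legs
    by (simp add: image_image image_Un Un_assoc insert_commute)
qed

lemma adjacent_star_spider_iff:
  "{x, y} \<in> edges (star_spider b1 b2) \<longleftrightarrow>
    (\<exists>i<b1. x = hub \<and> y = leaf i \<or> x = leaf i \<and> y = hub) \<or>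
    (\<exists>i<b2. x = hub \<and> y = mid i \<or> x = mid i \<and> y = hub) \<or>
    (\<exists>i<b2. x = mid i \<and> y = tip i \<or> x = tip i \<and> y = mid i)"
  unfolding edges_star_spider Un_iff image_iff Bex_def lessThan_iff doubleton_eq_iff by blast

lemma neighbours_star_spider:
  "neighbours (star_spider b1 b2) hub = leaf ` {..<b1} \<union> mid ` {..<b2}"
  "i < b1 \<Longrightarrow> neighbours (star_spider b1 b2) (leaf i) = {hub}"
  "i < b2 \<Longrightarrow> neighbours (star_spider b1 b2) (mid i) = {hub, tip i}"
  "i < b2 \<Longrightarrow> neighbours (star_spider b1 b2) (tip i) = {mid i}"
  by (auto simp: neighbours_def adjacent_star_spider_iff)

lemma vdeg_star_spider:
  "i < b1 \<Longrightarrow> vdeg (star_spider b1 b2) (leaf i) = 1"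
  "i < b2 \<Longrightarrow> vdeg (star_spider b1 b2) (mid i) = 2"
  "i < b2 \<Longrightarrow> vdeg (star_spider b1 b2) (tip i) = 1"
  "vdeg (star_spider b1 b2) hub = b1 + b2"
proof -
  have "card (leaf ` {..<b1} \<union> mid ` {..<b2}) = b1 + b2"
    by (subst card_Un_disjoint) (auto simp: card_image inj_on_def)
  then show "vdeg (star_spider b1 b2) hub = b1 + b2"
    by (simp add: vdeg_def neighbours_star_spider)
qed (simp_all add: vdeg_def neighbours_star_spider)

lemma sum_verts_star_spider:
  "(\<Sum>x\<in>verts (star_spider b1 b2). f x)
    = f hub + (\<Sum>i<b1. f (leaf i)) + (\<Sum>i<b2. f (mid i)) + (\<Sum>i<b2. f (tip i) :: real)"
proof -
  have "(\<Sum>x\<in>verts (star_spider b1 b2). f x)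
      = f hub + (sum f (leaf ` {..<b1}) + sum f (mid ` {..<b2}) + sum f (tip ` {..<b2}))"
    unfolding verts_star_spider
    by (subst sum.insert; (subst sum.union_disjoint)?; (subst sum.union_disjoint)?) auto
  then show ?thesis
    by (simp add: sum.reindex inj_on_def)
qed

text \<open>The distance argument is ignored in the star, where every leaf is at distance 1. The
  last clause covers the hub and pairs from the star and the spider.\<close>

fun spider_green :: "spider_vertex + spider_vertex \<Rightarrow> spider_vertex + spider_vertex \<Rightarrow> real" where
  "spider_green (Inl (Leg i _)) (Inl (Leg j _)) = of_bool (i = j)"
| "spider_green (Inr (Leg i k)) (Inr (Leg j l)) = of_bool (i = j) * real (min k l)"
| "spider_green _ _ = 0"

lemma grounded_star_spider:
  assumes "b2 \<ge> 1"
  shows "grounded_graph (star_spider b1 b2) hub spider_green"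
proof
  show "finite (verts (star_spider b1 b2))" by (simp add: verts_star_spider)
  show "x \<in> verts (star_spider b1 b2) \<and> x \<noteq> y" if "{x, y} \<in> edges (star_spider b1 b2)" for x y
    using that by (auto simp: verts_star_spider adjacent_star_spider_iff)
  show "neighbours (star_spider b1 b2) x \<noteq> {}" if "x \<in> verts (star_spider b1 b2)" for x
    using that assms by (auto simp: verts_star_spider neighbours_star_spider lessThan_empty_iff)
  show "hub \<in> verts (star_spider b1 b2)" by (simp add: verts_star_spider)
  show "spider_green x y = spider_green y x" for x y
    by (induction x y rule: spider_green.induct) (auto simp: min.commute)
  show "spider_green hub y = 0" for y by simp
  show "laplacian (star_spider b1 b2) (\<lambda>z. spider_green z y) x = of_bool (x = y)"
    if "x \<in> verts (star_spider b1 b2)" "y \<in> verts (star_spider b1 b2)" "x \<noteq> hub" for x y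
    using that by (auto simp: verts_star_spider neighbours_star_spider laplacian_def)
qed

text \<open>Distinct vertices on a common branch at the hub are the two vertices of one spider leg,
  and these are adjacent. So \<open>u\<close> and \<open>v\<close> share no branch, and no
  \<open>j\<close> shares one with both.\<close>

lemma green_separated:
  assumes "u \<in> verts (star_spider b1 b2)" "v \<in> verts (star_spider b1 b2)" "u \<noteq> v"
    "{u, v} \<notin> edges (star_spider b1 b2)"
  shows "spider_green j u * spider_green j v = 0" "spider_green u v = 0"
proof -
  show "spider_green j u * spider_green j v = 0"
    using assms by (cases "(j, u)" rule: spider_green.cases)
      (auto simp: verts_star_spider adjacent_star_spider_iff)
  show "spider_green u v = 0"
    using assms by (auto simp: verts_star_spider adjacent_star_spider_iff)
qed

section \<open>Sign of the change and count of the Braess edges\<close>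

lemma braess_star_spider_iff:
  assumes b: "b1 \<ge> 1" "b2 \<ge> 1"
    and u: "u \<in> verts (star_spider b1 b2)" and v: "v \<in> verts (star_spider b1 b2)"
    and uv: "u \<noteq> v" "{u, v} \<notin> edges (star_spider b1 b2)"
  shows "kemeny (star_spider b1 b2) < kemeny (add_edge {u, v} (star_spider b1 b2))
    \<longleftrightarrow> u \<in> range leaf \<and> v \<in> range leaf"
proof -
  let ?G = "star_spider b1 b2"
  interpret grounded_graph ?G hub spider_green
    using b(2) by (rule grounded_star_spider)
  define K where "K x = (\<Sum>j\<in>verts ?G. vdeg ?G j * (spider_green j x)\<^sup>2)" for x
  have sq: "(of_bool P :: real)\<^sup>2 = of_bool P" for P by simp
  \<comment> \<open>On a spider leg the degrees are 2 and 1 and the distances 1 and 2: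
    \<open>3 = 2 * 1 + 1 * 1\<close> and \<open>4 = 2 * 1 + 1 * 2\<close>; for \<open>K\<close>
    below, squared kernel values give \<open>6 = 2 * 1 + 1 * 4\<close>.\<close>
  have pot: "potential hub = 0" "\<And>i. i < b1 \<Longrightarrow> potential (leaf i) = 1"
    "\<And>i. i < b2 \<Longrightarrow> potential (mid i) = 3" "\<And>i. i < b2 \<Longrightarrow> potential (tip i) = 4"
    unfolding potential_def sum_verts_star_spider by (simp_all add: vdeg_star_spider)
  have K: "K hub = 0" "\<And>i. i < b1 \<Longrightarrow> K (leaf i) = 1"
    "\<And>i. i < b2 \<Longrightarrow> K (mid i) = 3" "\<And>i. i < b2 \<Longrightarrow> K (tip i) = 6"
    unfolding K_def sum_verts_star_spider by (simp_all add: vdeg_star_spider power_mult_distrib sq)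
  define W S where "W = total_degree ?G" and "S = (\<Sum>j\<in>verts ?G. vdeg ?G j * potential j)"
  have W: "W = 2 * real b1 + 4 * real b2"
    unfolding W_def total_degree_def sum_verts_star_spider by (simp add: vdeg_star_spider)
  have S: "S = real b1 + 10 * real b2"
    unfolding S_def sum_verts_star_spider by (simp add: vdeg_star_spider pot)
  let ?a = "spider_green u u" and ?b = "spider_green v v"
  \<comment> \<open>\<open>A\<close> is the change of the diagonal sum in \<open>kemeny_eq\<close>,
    \<open>B\<close> that of the double sum \<open>S\<close>; the total degree goes from
    \<open>W\<close> to \<open>W + 2\<close>.\<close>
  define A where "A = ?a + ?b - (K u + K v + ?a\<^sup>2 + ?b\<^sup>2) / (1 + ?a + ?b)"
  define B where "B = 2 * (potential u + potential v) + ?a + ?b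
    - (potential u - potential v + ?a - ?b)\<^sup>2 / (1 + ?a + ?b)"
  have W0: "W > 0" using W b by simp
  have "spider_green x x \<ge> 0" for x
    by (cases "(x, x)" rule: spider_green.cases) auto
  then have "1 + ?a + ?b \<noteq> 0"
    by (smt (verit))
  then have "kemeny (add_edge {u, v} ?G) - kemeny ?G = A + S / W - (S + B) / (W + 2)"
    using kemeny_add_edge_separated[OF u v uv green_separated[OF u v uv]]
    by (simp add: A_def B_def K_def W_def S_def)
  also have "\<dots> = (A * (W * (W + 2)) + 2 * S - B * W) / (W * (W + 2))"
    using W0 by (simp add: divide_simps) (simp add: algebra_simps)
  finally have sign: "kemeny ?G < kemeny (add_edge {u, v} ?G) \<longleftrightarrow> A * (W * (W + 2)) + 2 * S - B * W > 0"
    using W0 by (smt (verit) mult_pos_pos zero_less_divide_iff)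
  \<comment> \<open>Naming the quadratic term leaves inequalities linear in \<open>X\<close>,
    \<open>W\<close> and \<open>S\<close>. The factor 8 comes from \<open>W \<ge> 6\<close>.\<close>
  define X where "X = W * (W + 2)"
  have X: "X \<ge> 8 * W"
    using mult_left_mono[of 8 "W + 2" W] W b by (simp add: X_def mult.commute)
  show ?thesis
  proof (cases "u \<in> range leaf \<and> v \<in> range leaf")
    case True
    then have "b1 \<ge> 2" using u v uv by (auto simp: verts_star_spider)
    \<comment> \<open>Two distinct leaves give \<open>W \<ge> 8\<close>; then \<open>A * X\<close>
      alone exceeds \<open>B * W\<close>, as \<open>20 / 3 > 6\<close>.\<close>
    then have X10: "X \<ge> 10 * W"
      using mult_left_mono[of 10 "W + 2" W] W b by (simp add: X_def mult.commute)
    have AB: "A = 2 / 3" "B = 6"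
      using True u v by (auto simp: verts_star_spider A_def B_def K pot)
    have "A * X + 2 * S - B * W > 0"
      unfolding AB using X10 W S b by simp
    then show ?thesis
      unfolding sign X_def[symmetric] using True by simp
  next
    case False
    \<comment> \<open>Here \<open>A \<le> 0\<close> and \<open>2 * S \<le> 5 * W\<close>. For
      leaf-mid, leaf-tip and tip-tip pairs \<open>A = 0\<close> and \<open>B \<ge> 26 / 3\<close>.
      For mid-mid and mid-tip pairs \<open>A < 0\<close> and \<open>B \<ge> 14\<close>. For hub-tip
      pairs \<open>B = -2\<close>, but \<open>A = -4 / 3\<close> and \<open>X \<ge> 8 * W\<close>
      compensate.\<close>
    have "A * X + 2 * S - B * W \<le> 0"
      using u v uv False X b W S
      by (auto simp: verts_star_spider adjacent_star_spider_iff A_def B_def K pot power2_eq_square)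
    then show ?thesis
      unfolding sign X_def[symmetric] using False by auto
  qed
qed

text \<open>Any two leaves of the star are nonadjacent, so every pair of indices counts; the image
  form reduces the count to that of two-element subsets.\<close>

lemma braess_edges_star_spider:
  assumes "b1 \<ge> 1" "b2 \<ge> 1"
  shows "braess_edges (star_spider b1 b2) = (`) leaf ` {A. A \<subseteq> {..<b1} \<and> card A = 2}"
proof (intro equalityI subsetI)
  fix e assume "e \<in> braess_edges (star_spider b1 b2)"
  then obtain u v where "e = {u, v}" "u \<in> verts (star_spider b1 b2)" "v \<in> verts (star_spider b1 b2)"
    "u \<noteq> v" "u \<in> range leaf" "v \<in> range leaf"
    using braess_star_spider_iff[OF assms] by (auto simp: braess_edges_def)
  then obtain i k where "e = leaf ` {i, k}" "i < b1" "k < b1" "i \<noteq> k"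
    by (auto simp: verts_star_spider)
  then show "e \<in> (`) leaf ` {A. A \<subseteq> {..<b1} \<and> card A = 2}"
    by (intro image_eqI[of _ _ "{i, k}"]) auto
next
  fix e assume "e \<in> (`) leaf ` {A. A \<subseteq> {..<b1} \<and> card A = 2}"
  then obtain i k where e: "e = {leaf i, leaf k}" and ik: "i < b1" "k < b1" "i \<noteq> k"
    by (auto simp: card_2_iff)
  have "leaf i \<in> verts (star_spider b1 b2)" "leaf k \<in> verts (star_spider b1 b2)" "leaf i \<noteq> leaf k"
    "{leaf i, leaf k} \<notin> edges (star_spider b1 b2)"
    using ik by (auto simp: verts_star_spider adjacent_star_spider_iff)
  then show "e \<in> braess_edges (star_spider b1 b2)"
    unfolding braess_edges_def e using braess_star_spider_iff[OF assms] by blast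
qed

theorem theorem4p10:
  fixes b1 b2 :: nat
  assumes "b1 \<ge> 1" and "b2 \<ge> 1"
  shows "num_braess (identify (spider 1 b1) Center (spider 2 b2) Center) = b1 choose 2"
proof -
  have "inj_on ((`) leaf) {A. A \<subseteq> {..<b1} \<and> card A = 2}"
    by (intro inj_on_image) (auto simp: inj_on_def)
  then have "num_braess (star_spider b1 b2) = b1 choose 2"
    by (simp add: num_braess_def braess_edges_star_spider[OF assms] card_image n_subsets)
  then show ?thesis
    by (simp add: star_spider_def)
qed

end
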